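(* Let $\xi$ and $z$ be two commutative free variables (i.e. $n=1$). For any $m\ge2$, the polynomial $L_m(z;\xi)=\xi^m\ast z^m$ is irreducible in $\mathbb{Q}[\xi,z]$.
   Context: Here $\partial=\partial/\partial z$, $\delta=\partial/\partial\xi$, and the product $\ast$ on the vector space $\mathbb{C}[\xi,z]$ is $f\ast g:=\mu\big(e^{-\Omega}(f\otimes g)\big)$, where $\Omega=\partial\otimes\delta+\delta\otimes\partial$ and $\mu(f\otimes g)=fg$ is the usual multiplication. The polynomials $\xi^m\ast z^m$ have rational coefficients; irreducibility is in the usual polynomial ring $\mathbb{Q}[\xi,z]$. *)

theory Defs
  imports Complex_Main "HOL-Computational_Algebra.Polynomial"
begin

text \<open>
  The ring \<open>K[\<xi>, z]\<close> is represented as \<open>K[\<xi>][z]\<close>: the inner polynomial variable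
  is \<open>\<xi>\<close>, the outer one is \<open>z\<close>.
\<close>

type_synonym cpoly2 = "complex poly poly"

definition xi :: cpoly2 where "xi = [:[:0, 1:]:]"

definition zz :: cpoly2 where "zz = [:0, 1:]"

text \<open>\<open>\<partial> = \<partial>/\<partial>z\<close> and \<open>\<delta> = \<partial>/\<partial>\<xi>\<close>.\<close>

definition dz :: "cpoly2 \<Rightarrow> cpoly2" where "dz = pderiv"

definition dxi :: "cpoly2 \<Rightarrow> cpoly2" where "dxi = map_poly pderiv"

text \<open>
  The tensor square over \<open>\<complex>\<close> of \<open>A = \<complex>[\<xi>, z]\<close> is \<open>A \<otimes> \<complex>[\<xi>', z'] = A[\<xi>', z']\<close>, again
  with \<open>\<xi>'\<close> as the inner and \<open>z'\<close> as the outer variable. The left factor is the coefficient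
  ring; \<open>f \<otimes> g\<close> is \<open>f(\<xi>, z) g(\<xi>', z')\<close>.
\<close>

type_synonym cpoly2_tensor = "cpoly2 poly poly"

definition tensor :: "cpoly2 \<Rightarrow> cpoly2 \<Rightarrow> cpoly2_tensor" where
  "tensor f g = map_poly (map_poly (\<lambda>c. smult [:c:] f)) g"

definition mu :: "cpoly2_tensor \<Rightarrow> cpoly2" where
  "mu t = poly (map_poly (\<lambda>p. poly p xi) t) zz"

text \<open>\<open>D \<otimes> id\<close>, \<open>id \<otimes> \<partial>\<close> and \<open>id \<otimes> \<delta>\<close>; see the lemmas \<open>left_op_tensor\<close>,
  \<open>right_dz_tensor\<close> and \<open>right_dxi_tensor\<close>.\<close>

definition left_op :: "(cpoly2 \<Rightarrow> cpoly2) \<Rightarrow> cpoly2_tensor \<Rightarrow> cpoly2_tensor" where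
  "left_op D = map_poly (map_poly D)"

definition right_dz :: "cpoly2_tensor \<Rightarrow> cpoly2_tensor" where
  "right_dz = pderiv"

definition right_dxi :: "cpoly2_tensor \<Rightarrow> cpoly2_tensor" where
  "right_dxi = map_poly pderiv"

definition Omega :: "cpoly2_tensor \<Rightarrow> cpoly2_tensor" where
  "Omega t = left_op dz (right_dxi t) + left_op dxi (right_dz t)"

definition scale_tensor :: "complex \<Rightarrow> cpoly2_tensor \<Rightarrow> cpoly2_tensor" where
  "scale_tensor c t = smult [:[:[:c:]:]:] t"

text \<open>
  \<open>\<Omega>\<close> is locally nilpotent, so the exponential series applied to \<open>t\<close> has only finitely many
  nonzero terms (lemma \<open>finite_Omega_support\<close>); the sum ranges over exactly these.
\<close>

definition exp_neg_Omega :: "cpoly2_tensor \<Rightarrow> cpoly2_tensor" where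
  "exp_neg_Omega t =
     (\<Sum>k\<in>{k. (Omega ^^ k) t \<noteq> 0}. scale_tensor ((- 1) ^ k / fact k) ((Omega ^^ k) t))"

definition star :: "cpoly2 \<Rightarrow> cpoly2 \<Rightarrow> cpoly2"  (infixl "\<star>" 70) where
  "f \<star> g = mu (exp_neg_Omega (tensor f g))"

definition L :: "nat \<Rightarrow> cpoly2" where
  "L m = xi ^ m \<star> zz ^ m"

text \<open>The inclusion of \<open>\<rat>[\<xi>, z]\<close> into \<open>\<complex>[\<xi>, z]\<close>.\<close>

definition of_rat_poly2 :: "rat poly poly \<Rightarrow> cpoly2" where
  "of_rat_poly2 = map_poly (map_poly of_rat)"


lemma coeff_tensor: "coeff (coeff (tensor f g) i) j = smult [:coeff (coeff g i) j:] f"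
  by (simp add: tensor_def coeff_map_poly)

lemma coeff_left_op:
  "D 0 = 0 \<Longrightarrow> coeff (coeff (left_op D t) i) j = D (coeff (coeff t i) j)"
  by (simp add: left_op_def coeff_map_poly)

lemma left_op_tensor:
  assumes "\<And>c f. D (smult [:c:] f) = smult [:c:] (D f)"
  shows "left_op D (tensor f g) = tensor (D f) g"
proof -
  have "D 0 = 0" using assms[of 0 0] by simp
  then show ?thesis
    by (intro poly_eqI) (simp add: coeff_left_op coeff_tensor assms)
qed

lemma dz_smult: "dz (smult c f) = smult c (dz f)"
  by (simp add: dz_def pderiv_smult)

lemma dxi_smult: "dxi (smult [:c:] f) = smult [:c:] (dxi f)"
  by (intro poly_eqI) (simp add: dxi_def coeff_map_poly pderiv_smult)

lemma coeff_of_nat_mult: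
  fixes q :: "'a :: comm_semiring_1 poly"
  shows "coeff (of_nat n * q) k = of_nat n * coeff q k"
  by (simp add: of_nat_poly)

lemma right_dz_tensor: "right_dz (tensor f g) = tensor f (dz g)"
  by (intro poly_eqI)
    (simp add: right_dz_def dz_def coeff_tensor coeff_pderiv coeff_of_nat_mult
      mult.assoc del: of_nat_Suc)

lemma right_dxi_tensor: "right_dxi (tensor f g) = tensor f (dxi g)"
  by (intro poly_eqI)
    (simp add: right_dxi_def dxi_def coeff_tensor coeff_pderiv coeff_map_poly coeff_of_nat_mult
      mult.assoc del: of_nat_Suc)

lemma mu_tensor: "mu (tensor f g) = f * g"
proof -
  have inner: "poly (map_poly (\<lambda>c. smult [:c:] f) a) xi = f * [:a:]" for a
  proof (induction a)
    case (pCons c a)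
    have "[:pCons c a:] = [:[:c:]:] + xi * [:a:]"
      by (simp add: xi_def)
    then show ?case
      using pCons by (simp add: map_poly_pCons algebra_simps)
  qed simp
  show ?thesis
  proof (induction g)
    case 0
    then show ?case by (simp add: mu_def tensor_def)
  next
    case (pCons a p)
    have "mu (tensor f (pCons a p)) = f * [:a:] + zz * mu (tensor f p)"
      by (simp add: mu_def tensor_def map_poly_pCons inner)
    moreover have "pCons a p = [:a:] + zz * p"
      by (simp add: zz_def)
    ultimately show ?case
      using pCons by (simp add: algebra_simps)
  qed
qed

lemma coeff_Omega:
  "coeff (coeff (Omega t) i) j =
     dz (of_nat (Suc j) * coeff (coeff t i) (Suc j)) +
     dxi (of_nat (Suc i) * coeff (coeff t (Suc i)) j)"
  by (simp add: Omega_def right_dz_def right_dxi_def coeff_left_op dz_def dxi_def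
      coeff_map_poly coeff_pderiv of_nat_poly del: of_nat_Suc)

text \<open>\<open>\<Omega>\<close> lowers the total degree in \<open>\<xi>'\<close> and \<open>z'\<close>.\<close>

lemma Omega_power_coeff_eq_0:
  assumes "\<And>i j. coeff (coeff t i) j \<noteq> 0 \<Longrightarrow> i + j < n" and "n \<le> i + j + k"
  shows "coeff (coeff ((Omega ^^ k) t) i) j = 0"
  using assms(2)
proof (induction k arbitrary: i j)
  case 0
  then show ?case using assms(1)[of i j] by fastforce
next
  case (Suc k)
  then have "coeff (coeff ((Omega ^^ k) t) i) (Suc j) = 0"
    and "coeff (coeff ((Omega ^^ k) t) (Suc i)) j = 0"
    by auto
  then show ?case by (simp add: coeff_Omega dz_def dxi_def)
qed

lemma finite_Omega_support: "finite {k. (Omega ^^ k) t \<noteq> 0}"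
proof -
  define n where "n = Suc (degree t + (\<Sum>i\<le>degree t. degree (coeff t i)))"
  have bound: "i + j < n" if "coeff (coeff t i) j \<noteq> 0" for i j
  proof -
    have i: "i \<le> degree t" using that by (intro le_degree) auto
    have "j \<le> degree (coeff t i)" using that by (rule le_degree)
    also have "\<dots> \<le> (\<Sum>i\<le>degree t. degree (coeff t i))"
      using i by (intro member_le_sum) auto
    finally show ?thesis using i by (simp add: n_def)
  qed
  have "(Omega ^^ k) t = 0" if "n \<le> k" for k
    using that by (intro poly_eqI) (simp add: Omega_power_coeff_eq_0[OF bound])
  then have "{k. (Omega ^^ k) t \<noteq> 0} \<subseteq> {..<n}"
    by (auto simp: not_less[symmetric])
  then show ?thesis by (rule finite_subset) simp
qed

lemma inj_of_rat_poly2: "inj of_rat_poly2"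
proof (rule injI)
  fix p q assume "of_rat_poly2 p = of_rat_poly2 q"
  then have "coeff (coeff (of_rat_poly2 p) i) j = coeff (coeff (of_rat_poly2 q) i) j" for i j
    by simp
  then show "p = q"
    by (intro poly_eqI) (simp add: of_rat_poly2_def coeff_map_poly)
qed

end

theory Submission
  imports Defs
begin

text \<open>
  Expanding the exponential gives \<open>\<xi>\<^sup>m \<star> z\<^sup>m = \<Sum>\<^sub>j (-1)\<^sup>j j! (m choose j)\<^sup>2 (\<xi> z)\<^sup>m\<^sup>-\<^sup>j\<close>, which is the
  Laguerre polynomial of degree \<open>m\<close>, normalised to be monic, at the argument \<open>\<xi> z\<close>
  (\<open>L_eq_laguerre\<close>). A factorisation of \<open>p (\<xi> z)\<close> with \<open>p 0 \<noteq> 0\<close> comes from one of \<open>p\<close>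
  (\<open>irreducible_at_product\<close>), so it remains to prove Schur's theorem that the Laguerre polynomial
  is irreducible over the rationals.

  The argument for this is the one that Coleman gave for the truncated exponential series, with
  Newton polygons. Up to sign the coefficient of \<open>x\<^sup>k\<close> is \<open>(m choose k) m! / k!\<close>. For a prime \<open>p\<close>,
  the points \<open>(k, - v\<^sub>p (k!))\<close> have a lower convex hull over \<open>{0..m}\<close> whose vertices are the
  numbers obtained from \<open>m\<close> by deleting final digits in base \<open>p\<close>. The binomial coefficients
  do not change this hull: they are integers, and those at the vertices are prime to \<open>p\<close>. The edge
  from \<open>p\<^sup>n\<^sup>+\<^sup>1 (m div p\<^sup>n\<^sup>+\<^sup>1)\<close> to \<open>p\<^sup>n (m div p\<^sup>n)\<close> has slope \<open>- (p\<^sup>n - 1) / (p\<^sup>n (p - 1))\<close>, with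
  denominator \<open>p\<^sup>n\<close> in lowest terms (\<open>laguerre_left\<close>, \<open>laguerre_right\<close>). By the additivity of
  Newton polygons (\<open>extremal_index_mult\<close>), a factor has only edges with these slopes, and the
  length of an edge of slope with denominator \<open>p\<^sup>n\<close> is a multiple of \<open>p\<^sup>n\<close>. If \<open>p\<^sup>e\<close> divides
  \<open>m\<close>, the edges with \<open>n < e\<close> have length zero, so \<open>p\<^sup>e\<close> divides the degree of every factor
  (\<open>prime_power_dvd_degree_factor\<close>). Taking all primes together, \<open>m\<close> divides the degree of
  every factor, which therefore is \<open>0\<close> or \<open>m\<close>.

  Instead of a whole Newton polygon, the formalisation only follows the two ends of the edge of a
  given slope, which avoids convex hulls and extension fields.
\<close>

section \<open>Extremal points of Newton polygons\<close>

text \<open>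
  For \<open>D > 0\<close> the lines with slope \<open>- A / D\<close> in the plane of the points \<open>(i, v\<^sub>p (a\<^sub>i))\<close> are the
  level sets of this function, so its minima over the support of \<open>f\<close> lie on an edge or at a
  vertex of the Newton polygon. As \<^term>\<open>multiplicity p 0 = 0\<close>, only indices with a nonzero
  coefficient are meaningful.
\<close>

definition weight :: "int \<Rightarrow> int \<Rightarrow> int \<Rightarrow> int poly \<Rightarrow> nat \<Rightarrow> int" where
  "weight p D A f i = D * int (multiplicity p (coeff f i)) + A * int i"

text \<open>
  The sign of \<open>s\<close> breaks ties between several minimisers of the weight: \<open>s = 1\<close> selects the
  leftmost one and \<open>s = -1\<close> the rightmost one, that is, the left and the right end of the edge of
  slope \<open>- A / D\<close> (which may degenerate to a point). Treating both ends at once is the purpose of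
  this encoding.
\<close>
definition extremal_index :: "int \<Rightarrow> int \<Rightarrow> int \<Rightarrow> int \<Rightarrow> int poly \<Rightarrow> nat \<Rightarrow> bool" where
  "extremal_index p D A s f l \<longleftrightarrow> coeff f l \<noteq> 0 \<and>
     (\<forall>i. coeff f i \<noteq> 0 \<longrightarrow> i \<noteq> l \<longrightarrow>
        weight p D A f l < weight p D A f i \<or>
        weight p D A f l = weight p D A f i \<and> s * int l < s * int i)"

lemma extremal_indexD:
  assumes "extremal_index p D A s f l" "coeff f i \<noteq> 0" "i \<noteq> l"
  shows "weight p D A f l < weight p D A f i \<or>
         weight p D A f l = weight p D A f i \<and> s * int l < s * int i"
  using assms unfolding extremal_index_def by blast

lemma extremal_index_coeff: "extremal_index p D A s f l \<Longrightarrow> coeff f l \<noteq> 0"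
  unfolding extremal_index_def by blast

lemma extremal_index_weight_le:
  assumes "extremal_index p D A s f l" "coeff f i \<noteq> 0"
  shows "weight p D A f l \<le> weight p D A f i"
  using extremal_indexD[OF assms] by (cases "i = l") auto

lemma extremal_index_unique:
  assumes "extremal_index p D A s f l" "extremal_index p D A s f k"
  shows "l = k"
  using extremal_indexD[OF assms(1) extremal_index_coeff[OF assms(2)]]
    extremal_indexD[OF assms(2) extremal_index_coeff[OF assms(1)]] by fastforce

lemma extremal_index_exists:
  assumes "f \<noteq> 0" "s \<noteq> 0"
  shows "\<exists>l. extremal_index p D A s f l"
proof -
  define S where "S = {i. coeff f i \<noteq> 0}"
  have fin: "finite S"
    by (rule finite_subset[of _ "{..degree f}"]) (auto simp: S_def intro: le_degree)
  have "degree f \<in> S" using assms by (simp add: S_def)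
  then obtain k where "is_arg_min (weight p D A f) (\<lambda>x. x \<in> S) k"
    using ex_is_arg_min_if_finite[OF fin, of "weight p D A f"] by auto
  then have k: "k \<in> S" "\<And>i. i \<in> S \<Longrightarrow> weight p D A f k \<le> weight p D A f i"
    by (auto simp: is_arg_min_linorder)
  define T where "T = {i\<in>S. weight p D A f i = weight p D A f k}"
  have "finite T" "T \<noteq> {}" using fin k by (auto simp: T_def)
  then obtain l where "is_arg_min (\<lambda>i. s * int i) (\<lambda>x. x \<in> T) l"
    using ex_is_arg_min_if_finite[of T "\<lambda>i. s * int i"] by auto
  then have l: "l \<in> T" "\<And>i. i \<in> T \<Longrightarrow> s * int l \<le> s * int i"
    by (auto simp: is_arg_min_linorder)
  have "extremal_index p D A s f l"
    unfolding extremal_index_def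
  proof (intro conjI allI impI)
    show "coeff f l \<noteq> 0" using l by (simp add: T_def S_def)
    fix i assume i: "coeff f i \<noteq> 0" "i \<noteq> l"
    show "weight p D A f l < weight p D A f i \<or>
        weight p D A f l = weight p D A f i \<and> s * int l < s * int i"
    proof (cases "i \<in> T")
      case True
      have "s * int l \<noteq> s * int i" using i assms by simp
      with l(2)[OF True] have "s * int l < s * int i" by linarith
      with True l(1) show ?thesis by (simp add: T_def)
    next
      case False
      with i k(2)[of i] l(1) show ?thesis by (auto simp: T_def S_def)
    qed
  qed
  then show ?thesis ..
qed

text \<open>
  This is the additivity of Newton polygons (Dumas) restricted to one end of one edge. Sums of
  lexicographic keys \<open>(weight, s * index)\<close> are compatible with products of coefficients. In the
  coefficient of index \<open>l + k\<close> exactly one product attains the minimal key, all the others on the same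
  index have strictly larger valuation, so no cancellation occurs there; elsewhere the
  ultrametric inequality suffices.
\<close>
lemma extremal_index_mult:
  assumes p: "prime p" and D: "D > 0"
    and f: "extremal_index p D A s f l" and g: "extremal_index p D A s g k"
  shows "extremal_index p D A s (f * g) (l + k)"
proof -
  define v where "v i = multiplicity p (coeff f i)" for i
  define u where "u i = multiplicity p (coeff g i)" for i
  have pe: "prime_elem p" using p by (rule prime_imp_prime_elem)
  have np: "\<not> is_unit p" using p not_prime_unit by blast
  have term_mult: "multiplicity p (coeff f i * coeff g j) = v i + u j"
    if "coeff f i * coeff g j \<noteq> 0" for i j
    using that pe unfolding v_def u_def
    by (intro prime_elem_multiplicity_mult_distrib) auto
  have pair: "D * int (v l + u k) + A * int (l + k) < D * int (v i + u j) + A * int (i + j) \<or>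
      D * int (v l + u k) + A * int (l + k) = D * int (v i + u j) + A * int (i + j) \<and>
      s * int (l + k) < s * int (i + j)"
    if "coeff f i * coeff g j \<noteq> 0" "(i, j) \<noteq> (l, k)" for i j
  proof -
    have nz: "coeff f i \<noteq> 0" "coeff g j \<noteq> 0" using that by auto
    have 1: "i = l \<or> D * int (v l) + A * int l < D * int (v i) + A * int i \<or>
      D * int (v l) + A * int l = D * int (v i) + A * int i \<and> s * int l < s * int i"
      using extremal_indexD[OF f nz(1)] by (auto simp: weight_def v_def)
    have 2: "j = k \<or> D * int (u k) + A * int k < D * int (u j) + A * int j \<or>
      D * int (u k) + A * int k = D * int (u j) + A * int j \<and> s * int k < s * int j"
      using extremal_indexD[OF g nz(2)] by (auto simp: weight_def u_def)
    show ?thesis using 1 2 that(2) by (auto simp: algebra_simps)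
  qed
  have nz0: "coeff f l * coeff g k \<noteq> 0"
    using extremal_index_coeff[OF f] extremal_index_coeff[OF g] by simp
  define w where "w = v l + u k"
  have split: "coeff (f * g) (l + k) =
     coeff f l * coeff g k + (\<Sum>i\<in>{..l+k} - {l}. coeff f i * coeff g (l + k - i))"
    unfolding coeff_mult by (subst sum.remove[of _ l]) auto
  have rest: "p ^ Suc w dvd (\<Sum>i\<in>{..l+k} - {l}. coeff f i * coeff g (l + k - i))"
  proof (rule dvd_sum)
    fix i assume i: "i \<in> {..l+k} - {l}"
    show "p ^ Suc w dvd coeff f i * coeff g (l + k - i)"
    proof (cases "coeff f i * coeff g (l + k - i) = 0")
      case True
      then show ?thesis by (metis dvd_0_right)
    next
      case False
      have "D * int (v l + u k) < D * int (v i + u (l + k - i))"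
        using pair[OF False] i by auto
      then have "Suc w \<le> v i + u (l + k - i)" using D by (simp add: w_def)
      then show ?thesis
        using term_mult[OF False] by (intro multiplicity_dvd') simp
    qed
  qed
  have lead: "p ^ w dvd coeff f l * coeff g k" "\<not> p ^ Suc w dvd coeff f l * coeff g k"
    using term_mult[OF nz0] np nz0
    by (simp_all add: power_dvd_iff_le_multiplicity w_def del: power_Suc)
  have "\<not> p ^ Suc w dvd coeff (f * g) (l + k)"
    unfolding split using lead(2) by (simp only: dvd_add_left_iff[OF rest] not_False_eq_True)
  moreover have "p ^ w dvd coeff (f * g) (l + k)"
    unfolding split using lead(1) dvd_trans[OF le_imp_power_dvd rest] by (intro dvd_add) simp_all
  ultimately have mult: "multiplicity p (coeff (f * g) (l + k)) = w"
    and nz: "coeff (f * g) (l + k) \<noteq> 0"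
    by (auto intro: multiplicity_eqI)
  show ?thesis
    unfolding extremal_index_def
  proof (intro conjI allI impI nz)
    fix n assume n: "coeff (f * g) n \<noteq> 0" "n \<noteq> l + k"
    define t where "t = multiplicity p (coeff (f * g) n)"
    have "\<not> p ^ Suc t dvd coeff (f * g) n"
      using np n by (simp add: power_dvd_iff_le_multiplicity t_def del: power_Suc)
    then obtain i where i: "i \<le> n" "\<not> p ^ Suc t dvd coeff f i * coeff g (n - i)"
      unfolding coeff_mult using dvd_sum[of "{..n}" "p ^ Suc t" "\<lambda>i. coeff f i * coeff g (n - i)"]
      by auto
    then have nzi: "coeff f i * coeff g (n - i) \<noteq> 0" by auto
    then have "v i + u (n - i) \<le> t"
      using i np by (simp add: power_dvd_iff_le_multiplicity term_mult del: power_Suc mult_eq_0_iff)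
    then have "D * int (v i + u (n - i)) \<le> D * int t" using D by simp
    moreover have "(i, n - i) \<noteq> (l, k)" using n(2) i(1) by auto
    ultimately show "weight p D A (f * g) (l + k) < weight p D A (f * g) n \<or>
        weight p D A (f * g) (l + k) = weight p D A (f * g) n \<and> s * int (l + k) < s * int n"
      using pair[OF nzi] i(1) unfolding weight_def mult t_def[symmetric] w_def by auto
  qed
qed

text \<open>A larger \<open>A / D\<close> penalises large indices more, so the edge moves to the left.\<close>
lemma extremal_index_antimono_slope:
  assumes "D > 0" "D' > 0" "A * D' < A' * D"
    and l: "extremal_index p D A s f l" and r: "extremal_index p D' A' s' f r"
  shows "r \<le> l"
proof -
  define x y where "x = int (multiplicity p (coeff f l))" and "y = int (multiplicity p (coeff f r))"
  have "D * x + A * int l \<le> D * y + A * int r"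
    using extremal_index_weight_le[OF l extremal_index_coeff[OF r]] by (simp add: weight_def x_def y_def)
  then have "D' * (D * x + A * int l) \<le> D' * (D * y + A * int r)"
    using assms by simp
  moreover have "D' * y + A' * int r \<le> D' * x + A' * int l"
    using extremal_index_weight_le[OF r extremal_index_coeff[OF l]] by (simp add: weight_def x_def y_def)
  then have "D * (D' * y + A' * int r) \<le> D * (D' * x + A' * int l)"
    using assms by simp
  ultimately have "(A' * D - A * D') * (int l - int r) \<ge> 0"
    by (simp add: algebra_simps)
  then show ?thesis using assms(3) by (simp add: zero_le_mult_iff)
qed

text \<open>
  The two ends of an edge have the same weight while valuations are integers: an edge whose slope
  has denominator \<open>D\<close> has a horizontal length divisible by \<open>D\<close>.
\<close>
lemma extremal_index_dvd_diff:
  assumes "extremal_index p D A s f l" "extremal_index p D A s' f r" "coprime D A"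
  shows "D dvd int l - int r"
proof -
  have "weight p D A f l = weight p D A f r"
    using assms by (meson antisym extremal_index_weight_le extremal_index_coeff)
  then have "A * (int l - int r) =
      D * (int (multiplicity p (coeff f r)) - int (multiplicity p (coeff f l)))"
    by (simp add: weight_def algebra_simps)
  then have "D dvd A * (int l - int r)" by simp
  then show ?thesis using assms(3) by (simp add: coprime_dvd_mult_right_iff)
qed

text \<open>
  If the edges of the Newton polygon of \<open>f * g\<close> of slopes \<open>- A n / p ^ n\<close>, for \<open>n \<ge> e\<close>, cover the
  whole interval from \<open>0\<close> to the degree, then the corresponding edges of \<open>f\<close> cover the interval
  from \<open>0\<close> to \<open>degree f\<close>, and each of these has a length divisible by \<open>p ^ e\<close>.
\<close>
lemma prime_power_dvd_degree_factor:
  fixes p :: int and x :: "nat \<Rightarrow> nat" and A :: "nat \<Rightarrow> int"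
  assumes p: "prime p" and nz: "f \<noteq> 0" "g \<noteq> 0"
    and right: "\<And>n. e \<le> n \<Longrightarrow> extremal_index p (p ^ n) (A n) (-1) (f * g) (x n)"
    and left: "\<And>n. e \<le> n \<Longrightarrow> extremal_index p (p ^ n) (A n) 1 (f * g) (x (Suc n))"
    and slope: "\<And>n. p * A n < A (Suc n)" "\<And>n. coprime (p ^ n) (A n)"
    and ends: "x e = degree (f * g)" "x N = 0" "e \<le> N"
  shows "p ^ e dvd int (degree f)"
proof -
  have pos: "p ^ n > 0" for n using p by (simp add: prime_gt_0_int)
  have ex: "\<exists>r. \<forall>n. extremal_index p (p ^ n) (A n) s h (r n)" if "h \<noteq> 0" "s \<noteq> 0" for h s
    using extremal_index_exists[OF that] by (intro choice allI)
  obtain rf where rf: "\<And>n. extremal_index p (p ^ n) (A n) (-1) f (rf n)"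
    using ex[OF nz(1), of "-1"] by auto
  obtain rg where rg: "\<And>n. extremal_index p (p ^ n) (A n) (-1) g (rg n)"
    using ex[OF nz(2), of "-1"] by auto
  obtain lf where lf: "\<And>n. extremal_index p (p ^ n) (A n) 1 f (lf n)"
    using ex[OF nz(1), of 1] by auto
  obtain lg where lg: "\<And>n. extremal_index p (p ^ n) (A n) 1 g (lg n)"
    using ex[OF nz(2), of 1] by auto
  have xr: "x n = rf n + rg n" if "e \<le> n" for n
    using extremal_index_unique[OF right[OF that] extremal_index_mult[OF p pos rf rg]] .
  have xl: "x (Suc n) = lf n + lg n" if "e \<le> n" for n
    using extremal_index_unique[OF left[OF that] extremal_index_mult[OF p pos lf lg]] .
  have sl: "A n * p ^ Suc n < A (Suc n) * p ^ n" for n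
    using slope(1)[of n] pos[of n] mult_strict_right_mono[of "p * A n" "A (Suc n)" "p ^ n"]
    by (simp add: mult_ac)
  \<comment> \<open>Consecutive edges of either factor do not overlap. A gap in one of them would be a gap in the
    product, where the edges are adjacent.\<close>
  have glue: "rf (Suc n) = lf n" if "e \<le> n" for n
    using extremal_index_antimono_slope[OF pos pos sl lf rf, of n]
      extremal_index_antimono_slope[OF pos pos sl lg rg, of n]
      xr[of "Suc n"] xl[of n] that by simp
  have jump: "p ^ e dvd int (rf (Suc n)) - int (rf n)" if "e \<le> n" for n
  proof -
    have "p ^ n dvd int (lf n) - int (rf n)"
      by (rule extremal_index_dvd_diff[OF lf rf slope(2)])
    then show ?thesis using that glue[OF that] by (metis dvd_trans le_imp_power_dvd)
  qed
  have "p ^ e dvd int (rf n) - int (rf e)" if "e \<le> n" for n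
    using that
  proof (induction n rule: dec_induct)
    case (step n)
    have "p ^ e dvd (int (rf (Suc n)) - int (rf n)) + (int (rf n) - int (rf e))"
      using step jump by (intro dvd_add) auto
    then show ?case by simp
  qed simp
  then have "p ^ e dvd int (rf N) - int (rf e)" using ends by simp
  moreover have "rf N = 0" using xr[of N] ends by simp
  \<comment> \<open>The right ends add up to \<open>degree f + degree g\<close>, so neither can fall short of its degree.\<close>
  moreover have "rf e = degree f"
  proof -
    have "rf e \<le> degree f" "rg e \<le> degree g"
      using rf rg by (auto intro!: le_degree dest: extremal_index_coeff)
    moreover have "rf e + rg e = degree f + degree g"
      using xr[of e] ends(1) nz by (simp add: degree_mult_eq)
    ultimately show ?thesis by simp
  qed
  ultimately show ?thesis by simp
qed

section \<open>Prime powers dividing factorials and binomial coefficients\<close>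

text \<open>
  Only the multiples of \<open>p\<close> among \<open>1, \<dots>, k\<close> contribute, and dividing each of them by \<open>p\<close> leaves
  \<open>1, \<dots>, k div p\<close>. This is the recursive form of Legendre's formula.
\<close>
lemma multiplicity_fact_div:
  fixes p :: nat
  assumes "prime p"
  shows "multiplicity p (fact k :: nat) = k div p + multiplicity p (fact (k div p) :: nat)"
proof (induction k)
  case (Suc k)
  have pe: "prime_elem p" using assms by simp
  have np: "\<not> is_unit p" using assms not_prime_unit by blast
  have S: "multiplicity p (fact (Suc n) :: nat) = multiplicity p (Suc n) + multiplicity p (fact n :: nat)" for n
    using pe by (simp add: prime_elem_multiplicity_mult_distrib del: mult_Suc)
  show ?case
  proof (cases "p dvd Suc k")
    case True
    then obtain t where t: "Suc k = p * t" by (auto elim: dvdE)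
    then obtain t' where t': "t = Suc t'" by (cases t) auto
    have "Suc k div p = t" using t prime_gt_0_nat[OF assms] by simp
    moreover have "Suc k div p = Suc (k div p)" using True by (simp add: div_Suc dvd_eq_mod_eq_0)
    ultimately have "k div p = t'" using t' by simp
    moreover have "multiplicity p (Suc k) = Suc (multiplicity p t)"
      unfolding t using np t' assms by (intro multiplicity_times_same) auto
    ultimately show ?thesis
      using S[of k] S[of t'] Suc \<open>Suc k div p = t\<close> t' by simp
  next
    case False
    then have "Suc k div p = k div p" by (simp add: div_Suc dvd_eq_mod_eq_0)
    then show ?thesis using S[of k] Suc False by (simp add: not_dvd_imp_multiplicity_0)
  qed
qed simp

text \<open>
  The number \<open>(p ^ n - 1) / (p - 1)\<close>, which is the exponent of \<open>p\<close> in the factorial of \<open>p ^ n\<close>.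
  The numbers \<open>repunit p n / p ^ n\<close> are the slopes of the Newton polygon below.
\<close>
definition repunit :: "nat \<Rightarrow> nat \<Rightarrow> nat" where
  "repunit p n = (\<Sum>i<n. p ^ i)"

lemma repunit_Suc: "repunit p (Suc n) = p ^ n + repunit p n"
  by (simp add: repunit_def)

lemma repunit_Suc': "repunit p (Suc n) = Suc (p * repunit p n)"
  unfolding repunit_def by (subst sum.lessThan_Suc_shift) (simp add: sum_distrib_left)

lemma coprime_repunit: "coprime (p ^ n) (repunit p n)"
proof (cases n)
  case (Suc k)
  have "coprime p (Suc (p * repunit p k))"
    by (metis coprime_Suc_right_nat coprime_mult_left_iff)
  then show ?thesis by (simp add: Suc repunit_Suc' del: power_Suc)
qed simp

lemma multiplicity_fact_split:
  fixes p :: nat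
  assumes "prime p" "r < p ^ n"
  shows "multiplicity p (fact (p ^ n * q + r) :: nat) =
    repunit p n * q + multiplicity p (fact q :: nat) + multiplicity p (fact r :: nat)"
  using assms(2)
proof (induction n arbitrary: r)
  case 0
  then show ?case by (simp add: repunit_def)
next
  case (Suc n)
  have p0: "p > 0" using assms prime_gt_0_nat by blast
  have lt: "r div p < p ^ n"
    using Suc.prems by (simp add: less_mult_imp_div_less mult.commute)
  have d: "(p ^ Suc n * q + r) div p = p ^ n * q + r div p"
    using p0 by (simp add: mult.assoc)
  show ?case
    unfolding multiplicity_fact_div[OF assms(1), of "p ^ Suc n * q + r"]
      multiplicity_fact_div[OF assms(1), of r] d Suc.IH[OF lt] repunit_Suc
    by (simp add: algebra_simps)
qed

text \<open>
  Inside a block of length \<open>p ^ n\<close>, the points \<open>(r, v\<^sub>p (r!))\<close> lie strictly below the line joining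
  the origin to \<open>(p ^ n, v\<^sub>p ((p ^ n)!))\<close>.
\<close>
lemma multiplicity_fact_less:
  fixes p :: nat
  assumes "prime p" "0 < r" "r < p ^ n"
  shows "p ^ n * multiplicity p (fact r :: nat) < repunit p n * r"
  using assms(2,3)
proof (induction n arbitrary: r)
  case (Suc n)
  define t where "t = r div p"
  have lt: "t < p ^ n"
    using Suc.prems by (simp add: t_def less_mult_imp_div_less mult.commute)
  have R: "p * t + r mod p = r" by (simp add: t_def)
  have v: "multiplicity p (fact r :: nat) = t + multiplicity p (fact t :: nat)"
    unfolding t_def by (rule multiplicity_fact_div[OF assms(1)])
  show ?case
  proof (cases "t = 0")
    case True
    then show ?thesis using v Suc.prems by (simp add: repunit_Suc')
  next
    case False
    have "p ^ Suc n * multiplicity p (fact r :: nat) =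
        p * (p ^ n * t + p ^ n * multiplicity p (fact t :: nat))"
      by (simp add: v algebra_simps)
    also have "\<dots> < p * (p ^ n * t + repunit p n * t)"
      using Suc.IH[OF _ lt] False assms(1) by (simp add: prime_gt_0_nat)
    also have "\<dots> = repunit p (Suc n) * (p * t)" by (simp add: repunit_Suc algebra_simps)
    also have "\<dots> \<le> repunit p (Suc n) * r" using R by (intro mult_left_mono) auto
    finally show ?thesis .
  qed
qed simp

lemma multiplicity_fact_mono:
  "q \<le> (Q :: nat) \<Longrightarrow> multiplicity p (fact q :: nat) \<le> multiplicity p (fact Q :: nat)"
  by (rule dvd_imp_multiplicity_le) (auto intro: fact_dvd)

text \<open>The valuation of the factorial jumps at each multiple of \<open>p\<close>; the last jump up to \<open>Q\<close> is at
  \<open>p * (Q div p)\<close>.\<close>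
lemma multiplicity_fact_strict_mono:
  fixes p :: nat
  assumes "prime p" "q < p * (Q div p)"
  shows "multiplicity p (fact q :: nat) < multiplicity p (fact Q :: nat)"
proof -
  have "q div p < Q div p"
    using assms by (simp add: less_mult_imp_div_less mult.commute)
  then show ?thesis
    using multiplicity_fact_mono[of "q div p" "Q div p" p]
      multiplicity_fact_div[OF assms(1), of q] multiplicity_fact_div[OF assms(1), of Q] by simp
qed

lemma multiplicity_binomial:
  fixes p :: nat
  assumes "prime p" "k \<le> m"
  shows "multiplicity p (fact m :: nat) = multiplicity p (m choose k) +
    multiplicity p (fact k :: nat) + multiplicity p (fact (m - k) :: nat)"
proof -
  have pe: "prime_elem p" using assms by simp
  have "m choose k \<noteq> 0" using assms by simp
  then show ?thesis
    unfolding binomial_fact_lemma[OF assms(2), symmetric]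
    using pe by (simp add: prime_elem_multiplicity_mult_distrib)
qed

text \<open>
  Deleting the last \<open>n\<close> digits of \<open>m\<close> in base \<open>p\<close> gives a lower index for which no carry occurs,
  so the binomial coefficient is prime to \<open>p\<close> (a case of Lucas's theorem).
\<close>
lemma multiplicity_binomial_truncate:
  fixes p :: nat
  assumes "prime p"
  shows "multiplicity p (m choose (p ^ n * (m div p ^ n))) = 0"
proof -
  define q where "q = m div p ^ n"
  define r where "r = m mod p ^ n"
  have m: "m = p ^ n * q + r" by (simp add: q_def r_def)
  have "r < p ^ n" using assms by (simp add: r_def prime_gt_0_nat)
  moreover have "multiplicity p (fact (p ^ n * q) :: nat) =
      repunit p n * q + multiplicity p (fact q :: nat)"
    using multiplicity_fact_split[OF assms, of 0 n q] assms by (simp add: prime_gt_0_nat)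
  ultimately show ?thesis
    using multiplicity_binomial[OF assms, of "p ^ n * q" m] multiplicity_fact_split[OF assms, of r n q]
    by (simp add: m[symmetric] q_def[symmetric]) (simp add: m)
qed

section \<open>Irreducibility of the Laguerre polynomials\<close>

text \<open>
  Up to the factor \<open>(-1) ^ m * m!\<close> this is the classical Laguerre polynomial
  \<open>\<Sum>k. (m choose k) * (- x) ^ k / k!\<close>; it is normalised to be monic with integer coefficients.
\<close>
definition laguerre :: "nat \<Rightarrow> 'a :: {comm_ring_1, semiring_char_0} poly" where
  "laguerre m = (\<Sum>k\<le>m. monom ((- 1) ^ (m - k) * fact (m - k) * of_nat (m choose k) ^ 2) k)"

lemma coeff_laguerre:
  "coeff (laguerre m) k = (- 1) ^ (m - k) * fact (m - k) * of_nat (m choose k) ^ 2"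
  by (cases "k \<le> m") (simp_all add: laguerre_def coeff_sum not_le binomial_eq_0)

lemma degree_laguerre: "degree (laguerre m :: 'a :: {idom, semiring_char_0} poly) = m"
  by (intro antisym le_degree degree_le) (auto simp: coeff_laguerre)

lemma multiplicity_int_of_nat:
  fixes p k :: nat
  assumes "\<not> is_unit p" "k \<noteq> 0"
  shows "multiplicity (int p) (int k) = multiplicity p k"
proof (rule multiplicity_eqI)
  show "int p ^ multiplicity p k dvd int k"
    by (metis int_dvd_int_iff multiplicity_dvd of_nat_power)
  show "\<not> int p ^ Suc (multiplicity p k) dvd int k"
    using assms by (metis int_dvd_int_iff multiplicity_dvd' of_nat_power not_less_eq_eq
        order_refl power_dvd_iff_le_multiplicity)
qed

text \<open>
  The coefficient of index \<open>k\<close> is, up to sign, \<open>(m choose k) * m! / k!\<close>. The constant \<open>c\<close>, which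
  only shifts all valuations, makes room for cleared denominators.
\<close>
lemma multiplicity_coeff_laguerre:
  fixes p :: nat
  assumes "prime p" "c \<noteq> 0" "k \<le> m"
  shows "int (multiplicity (int p) (coeff (smult c (laguerre m)) k)) =
    int (multiplicity (int p) c) + int (multiplicity p (fact m :: nat))
      + int (multiplicity p (m choose k)) - int (multiplicity p (fact k :: nat))"
proof -
  have np: "\<not> is_unit p" using assms(1) not_prime_unit by blast
  have pe: "prime_elem (int p)" "prime_elem p" using assms(1) by (auto intro: prime_imp_prime_elem)
  have ch: "m choose k \<noteq> 0" using assms by simp
  define a where "a = fact (m - k) * (m choose k) ^ 2"
  have a0: "a \<noteq> 0" using ch by (simp add: a_def)
  have "coeff (smult c (laguerre m)) k = (- 1) ^ (m - k) * (c * int a)"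
    by (simp add: coeff_laguerre a_def mult_ac)
  then have "multiplicity (int p) (coeff (smult c (laguerre m)) k) = multiplicity (int p) (c * int a)"
    by (simp only: multiplicity_times_unit_right is_unit_power_iff dvd_refl minus_dvd_iff simp_thms)
  also have "\<dots> = multiplicity (int p) c + multiplicity p a"
    using pe a0 assms np by (simp add: prime_elem_multiplicity_mult_distrib multiplicity_int_of_nat)
  also have "multiplicity p a = multiplicity p (fact (m - k) :: nat) + 2 * multiplicity p (m choose k)"
    using pe ch unfolding a_def
    by (simp add: prime_elem_multiplicity_mult_distrib power2_eq_square)
  finally show ?thesis using multiplicity_binomial[OF assms(1,3)] by simp
qed

text \<open>
  With \<open>k = p ^ n * q + r\<close>, the weight for the slope \<open>repunit p n / p ^ n\<close> splits into a constant,
  the nonnegative contribution of the binomial coefficient, a part depending on \<open>q\<close> and a part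
  depending on \<open>r\<close>; the terms linear in \<open>q\<close> cancel. This is why exactly these slopes occur.
\<close>
lemma weight_laguerre:
  fixes p :: nat
  assumes "prime p" "c \<noteq> 0" "k \<le> m"
  shows "weight (int p) (int p ^ n) (int (repunit p n)) (smult c (laguerre m)) k =
    int p ^ n * (int (multiplicity (int p) c) + int (multiplicity p (fact m :: nat)))
    + int p ^ n * int (multiplicity p (m choose k))
    - int p ^ n * int (multiplicity p (fact (k div p ^ n) :: nat))
    + (int (repunit p n) * int (k mod p ^ n)
        - int p ^ n * int (multiplicity p (fact (k mod p ^ n) :: nat)))"
proof -
  define q where "q = k div p ^ n"
  define r where "r = k mod p ^ n"
  have k: "k = p ^ n * q + r" by (simp add: q_def r_def)
  have "r < p ^ n" using assms by (simp add: r_def prime_gt_0_nat)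
  then have "multiplicity p (fact k :: nat) =
      repunit p n * q + multiplicity p (fact q :: nat) + multiplicity p (fact r :: nat)"
    unfolding k by (rule multiplicity_fact_split[OF assms(1)])
  moreover have "int k = int p ^ n * int q + int r" by (simp add: k)
  ultimately show ?thesis
    unfolding weight_def multiplicity_coeff_laguerre[OF assms] q_def[symmetric] r_def[symmetric]
    by (simp add: algebra_simps)
qed

lemma div_power_Suc: "m div p ^ Suc n = m div p ^ n div (p :: nat)"
  by (simp only: power_Suc2 div_mult2_eq)

context
  fixes p m :: nat and c :: int
  assumes p: "prime p" and c: "c \<noteq> 0"
begin

lemma coeff_smult_laguerre_eq_0_iff: "coeff (smult c (laguerre m)) k = 0 \<longleftrightarrow> k > m"
  using c by (auto simp: coeff_laguerre)

definition minimum_weight where "minimum_weight n =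
    int p ^ n * (int (multiplicity (int p) c) + int (multiplicity p (fact m :: nat)))
    - int p ^ n * int (multiplicity p (fact (m div p ^ n) :: nat))"

text \<open>
  The part depending on \<open>r\<close> is positive unless \<open>r = 0\<close>, and the part depending on \<open>q\<close> is smallest when
  \<open>v\<^sub>p (q!)\<close> reaches its value at \<open>m div p ^ n\<close>, which happens only from the last
  multiple of \<open>p\<close> on.
\<close>
lemma weight_laguerre_ge:
  assumes "k \<le> m"
  shows "minimum_weight n \<le>
    weight (int p) (int p ^ n) (int (repunit p n)) (smult c (laguerre m)) k"
    and "k mod p ^ n \<noteq> 0 \<or> k div p ^ n < p * (m div p ^ Suc n) \<Longrightarrow> minimum_weight n <
    weight (int p) (int p ^ n) (int (repunit p n)) (smult c (laguerre m)) k"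
proof -
  have pn: "int p ^ n > 0" using p by (simp add: prime_gt_0_nat)
  have "k div p ^ n \<le> m div p ^ n" using assms by (rule div_le_mono)
  then have 1: "int p ^ n * int (multiplicity p (fact (k div p ^ n) :: nat)) \<le>
      int p ^ n * int (multiplicity p (fact (m div p ^ n) :: nat))"
    using multiplicity_fact_mono by (intro mult_left_mono) auto
  have 2: "int p ^ n * int (multiplicity p (fact (k div p ^ n) :: nat)) <
      int p ^ n * int (multiplicity p (fact (m div p ^ n) :: nat))"
    if "k div p ^ n < p * (m div p ^ Suc n)"
    using multiplicity_fact_strict_mono[OF p, of "k div p ^ n" "m div p ^ n"] that pn
    by (simp add: div_power_Suc del: power_Suc)
  have 3: "int p ^ n * int (multiplicity p (fact (k mod p ^ n) :: nat)) <
      int (repunit p n) * int (k mod p ^ n)" if "k mod p ^ n \<noteq> 0"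
    using multiplicity_fact_less[OF p, of "k mod p ^ n" n] that p
    by (simp add: prime_gt_0_nat flip: of_nat_mult of_nat_power)
  then have 4: "int p ^ n * int (multiplicity p (fact (k mod p ^ n) :: nat)) \<le>
      int (repunit p n) * int (k mod p ^ n)" by (cases "k mod p ^ n = 0") auto
  have 5: "int p ^ n * int (multiplicity p (m choose k)) \<ge> 0" by simp
  note w = weight_laguerre[OF p c assms, of n] minimum_weight_def[of n]
  show "minimum_weight n \<le>
    weight (int p) (int p ^ n) (int (repunit p n)) (smult c (laguerre m)) k"
    using 1 4 5 unfolding w by linarith
  show "minimum_weight n <
    weight (int p) (int p ^ n) (int (repunit p n)) (smult c (laguerre m)) k"
    if "k mod p ^ n \<noteq> 0 \<or> k div p ^ n < p * (m div p ^ Suc n)"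
    using that 1 2 3 4 5 unfolding w by linarith
qed

lemma weight_laguerre_right:
  "weight (int p) (int p ^ n) (int (repunit p n)) (smult c (laguerre m)) (p ^ n * (m div p ^ n))
    = minimum_weight n"
  using p by (subst weight_laguerre[OF p c])
    (simp_all add: multiplicity_binomial_truncate minimum_weight_def prime_gt_0_nat)

lemma weight_laguerre_left:
  "weight (int p) (int p ^ n) (int (repunit p n)) (smult c (laguerre m))
     (p ^ Suc n * (m div p ^ Suc n)) = minimum_weight n"
proof -
  have d: "p ^ Suc n * (m div p ^ Suc n) = p ^ n * (p * (m div p ^ n div p))"
    by (simp add: div_power_Suc mult_ac del: power_Suc) (simp add: mult_ac)
  have "multiplicity p (fact (p * (m div p ^ n div p)) :: nat) = multiplicity p (fact (m div p ^ n) :: nat)"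
    using multiplicity_fact_div[OF p, of "p * (m div p ^ n div p)"]
      multiplicity_fact_div[OF p, of "m div p ^ n"] p by (simp add: prime_gt_0_nat)
  moreover have "p ^ Suc n * (m div p ^ Suc n) div p ^ n = p * (m div p ^ n div p)"
    "p ^ Suc n * (m div p ^ Suc n) mod p ^ n = 0"
    unfolding d using p by (simp_all add: prime_gt_0_nat)
  ultimately show ?thesis
    by (subst weight_laguerre[OF p c])
      (simp_all add: multiplicity_binomial_truncate[OF p] minimum_weight_def del: power_Suc)
qed

text \<open>
  The edge number \<open>n\<close> thus joins the truncations of \<open>m\<close> to its digits of place value at least
  \<open>p ^ Suc n\<close> and at least \<open>p ^ n\<close>, so consecutive edges are adjacent.
\<close>
lemma laguerre_right:
  "extremal_index (int p) (int p ^ n) (int (repunit p n)) (-1) (smult c (laguerre m))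
     (p ^ n * (m div p ^ n))"
  unfolding extremal_index_def weight_laguerre_right
proof (intro conjI allI impI)
  show "coeff (smult c (laguerre m)) (p ^ n * (m div p ^ n)) \<noteq> 0"
    unfolding coeff_smult_laguerre_eq_0_iff by (simp add: not_less)
  fix k assume k: "coeff (smult c (laguerre m)) k \<noteq> 0" "k \<noteq> p ^ n * (m div p ^ n)"
  then have km: "k \<le> m" unfolding coeff_smult_laguerre_eq_0_iff by simp
  show "minimum_weight n < weight (int p) (int p ^ n) (int (repunit p n)) (smult c (laguerre m)) k \<or>
    minimum_weight n = weight (int p) (int p ^ n) (int (repunit p n)) (smult c (laguerre m)) k \<and>
    - 1 * int (p ^ n * (m div p ^ n)) < - 1 * int k"
  proof (cases "k mod p ^ n = 0")
    case True
    then have "k = p ^ n * (k div p ^ n)" by (simp add: mult.commute mod_0_imp_dvd)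
    also have "\<dots> \<le> p ^ n * (m div p ^ n)" using km by (intro mult_left_mono div_le_mono) auto
    finally show ?thesis using k(2) weight_laguerre_ge(1)[OF km, of n] by linarith
  qed (use weight_laguerre_ge(2)[OF km] in blast)
qed

lemma laguerre_left:
  "extremal_index (int p) (int p ^ n) (int (repunit p n)) 1 (smult c (laguerre m))
     (p ^ Suc n * (m div p ^ Suc n))"
  unfolding extremal_index_def weight_laguerre_left
proof (intro conjI allI impI)
  show "coeff (smult c (laguerre m)) (p ^ Suc n * (m div p ^ Suc n)) \<noteq> 0"
    unfolding coeff_smult_laguerre_eq_0_iff by (metis not_less times_div_less_eq_dividend)
  fix k assume k: "coeff (smult c (laguerre m)) k \<noteq> 0" "k \<noteq> p ^ Suc n * (m div p ^ Suc n)"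
  then have km: "k \<le> m" unfolding coeff_smult_laguerre_eq_0_iff by simp
  have "k div p ^ n < p * (m div p ^ Suc n)" if "k < p ^ Suc n * (m div p ^ Suc n)"
    using that by (intro less_mult_imp_div_less) (simp add: mult_ac)
  then show "minimum_weight n < weight (int p) (int p ^ n) (int (repunit p n)) (smult c (laguerre m)) k \<or>
    minimum_weight n = weight (int p) (int p ^ n) (int (repunit p n)) (smult c (laguerre m)) k \<and>
    1 * int (p ^ Suc n * (m div p ^ Suc n)) < 1 * int k"
    using k(2) weight_laguerre_ge[OF km, of n] by (metis linorder_neqE_nat mult_1 of_nat_less_iff order_le_less)
qed

text \<open>
  If \<open>p ^ e\<close> divides \<open>m\<close>, then the edges with \<open>n \<ge> e\<close> already reach \<open>m\<close>, the last \<open>e\<close> digits being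
  zero; for large \<open>n\<close> all digits are deleted.
\<close>
lemma prime_power_dvd_degree_laguerre_factor:
  assumes fg: "f * g = smult c (laguerre m)" and e: "p ^ e dvd m"
  shows "p ^ e dvd degree f"
proof -
  have nz: "smult c (laguerre m) \<noteq> 0"
    using coeff_smult_laguerre_eq_0_iff[of m] by auto
  have "m < p ^ m" using prime_gt_1_nat[OF p] by (simp add: power_gt_expt)
  also have "p ^ m \<le> p ^ max e m"
    using prime_gt_0_nat[OF p] by (intro power_increasing) auto
  finally have "m div p ^ max e m = 0" by (rule div_less)
  then have N: "p ^ max e m * (m div p ^ max e m) = 0" by simp
  have "int p ^ e dvd int (degree f)"
  proof (rule prime_power_dvd_degree_factor[where x = "\<lambda>n. p ^ n * (m div p ^ n)"
        and A = "\<lambda>n. int (repunit p n)" and N = "max e m" and g = g])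
    show "prime (int p)" using p by simp
    show "f \<noteq> 0" "g \<noteq> 0" using fg nz by auto
    show "int p * int (repunit p n) < int (repunit p (Suc n))" for n
      by (simp add: repunit_Suc')
    show "coprime (int p ^ n) (int (repunit p n))" for n
      using coprime_repunit[of p n] by (simp flip: of_nat_power)
    show "p ^ e * (m div p ^ e) = degree (f * g)"
      using e c by (simp add: fg degree_laguerre)
    show "p ^ max e m * (m div p ^ max e m) = 0" by (rule N)
  qed (unfold fg, auto intro: laguerre_right laguerre_left simp del: power_Suc)
  then show ?thesis by (simp flip: of_nat_power)
qed

end

lemma map_poly_mult_hom:
  fixes h :: "'a :: comm_ring_1 \<Rightarrow> 'b :: comm_ring_1"
  assumes h: "h 0 = 0" "\<And>x y. h (x + y) = h x + h y" "\<And>x y. h (x * y) = h x * h y"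
  shows "map_poly h (f * g) = map_poly h f * map_poly h g"
proof -
  have "h (sum u I) = (\<Sum>i\<in>I. h (u i))" for u :: "nat \<Rightarrow> 'a" and I
    by (induction I rule: infinite_finite_induct) (simp_all add: h)
  then show ?thesis
    by (intro poly_eqI) (simp add: coeff_map_poly coeff_mult h)
qed

text \<open>
  By the local statements at all primes, \<open>m\<close> divides the degree of every factor, and that degree is at
  most \<open>m\<close>.
\<close>
lemma laguerre_factor_degree:
  fixes f g :: "int poly"
  assumes "f * g = smult c (laguerre m)" "c \<noteq> 0" "m > 0"
  shows "degree f = 0 \<or> degree g = 0"
proof (rule ccontr)
  assume "\<not> ?thesis"
  then have deg: "degree f \<noteq> 0" "degree g \<noteq> 0" by auto
  then have "degree f + degree g = degree (f * g)" by (subst degree_mult_eq) auto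
  also have "\<dots> = m" using assms by (simp add: degree_laguerre)
  finally have "degree f < m" using deg by simp
  moreover have "m dvd degree f"
  proof (rule multiplicity_le_imp_dvd)
    fix p :: nat assume p: "prime p"
    then have "p ^ multiplicity p m dvd degree f"
      using prime_power_dvd_degree_laguerre_factor[OF p assms(2,1)] multiplicity_dvd by blast
    then show "multiplicity p m \<le> multiplicity p (degree f)"
      using p deg by (intro multiplicity_geI) (auto simp: not_prime_unit)
  qed (use assms in auto)
  ultimately show False using deg by (auto dest: dvd_imp_le)
qed

lemma clear_denominators:
  fixes f :: "rat poly"
  shows "\<exists>c F. c \<noteq> 0 \<and> smult (of_int c) f = map_poly of_int F"
proof (induction f)
  case 0
  show ?case by (intro exI[of _ 1] exI[of _ 0]) simp
next
  case (pCons a f)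
  then obtain c F where F: "c \<noteq> 0" "smult (of_int c) f = map_poly of_int F" by blast
  obtain x y where xy: "a = of_int x / of_int y" "y \<noteq> 0"
    by (metis Fract_of_int_quotient Rat_cases less_irrefl)
  have "smult (of_int (c * y)) (pCons a f) = map_poly of_int (pCons (c * x) (smult y F))"
  proof (rule poly_eqI)
    fix n
    show "coeff (smult (of_int (c * y)) (pCons a f)) n =
      coeff (map_poly of_int (pCons (c * x) (smult y F))) n"
      using arg_cong[OF F(2), of "\<lambda>q. coeff q (n - 1)"] xy
      by (cases n) (simp_all add: coeff_map_poly mult_ac)
  qed
  then show ?case using F xy by (intro exI[of _ "c * y"]) auto
qed

lemma map_poly_laguerre_of_int:
  "map_poly of_int (laguerre m) = (laguerre m :: rat poly)"
  by (intro poly_eqI) (simp add: coeff_map_poly coeff_laguerre)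

theorem irreducible_laguerre:
  assumes "m > 0"
  shows "irreducible (laguerre m :: rat poly)"
proof (rule irreducibleI)
  show "laguerre m \<noteq> (0 :: rat poly)"
    using assms degree_laguerre[of m, where 'a = rat] by auto
  then show "\<not> is_unit (laguerre m :: rat poly)"
    using assms degree_laguerre[of m, where 'a = rat] by (simp add: is_unit_iff_degree)
  fix a b :: "rat poly" assume ab: "laguerre m = a * b"
  obtain c F where F: "c \<noteq> 0" "smult (of_int c) a = map_poly of_int F"
    using clear_denominators by blast
  obtain d G where G: "d \<noteq> 0" "smult (of_int d) b = map_poly of_int G"
    using clear_denominators by blast
  have "map_poly of_int (F * G) = smult (of_int c) a * smult (of_int d) b"
    unfolding F G by (rule map_poly_mult_hom) auto
  also have "\<dots> = map_poly of_int (smult (c * d) (laguerre m))"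
    by (intro poly_eqI) (simp add: coeff_map_poly coeff_laguerre mult_ac flip: ab)
  finally have "F * G = smult (c * d) (laguerre m)"
    by (simp add: poly_eq_iff coeff_map_poly del: coeff_smult)
  then have "degree F = 0 \<or> degree G = 0"
    using F G assms by (intro laguerre_factor_degree[where c = "c * d"]) auto
  moreover have "degree (map_poly (of_int :: int \<Rightarrow> rat) P) = degree P" for P
    by (rule degree_map_poly) simp
  then have "degree a = degree F" "degree b = degree G"
    using F G by (metis degree_smult_eq of_int_eq_0_iff)+
  moreover have "a \<noteq> 0" "b \<noteq> 0" using ab \<open>laguerre m \<noteq> 0\<close> by auto
  ultimately show "is_unit a \<or> is_unit b" by (auto simp: is_unit_iff_degree)
qed

section \<open>Substituting the product of the two variables\<close>

text \<open>The polynomial \<open>p (\<xi> z)\<close>, with \<open>\<xi>\<close> as the inner variable.\<close>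
definition at_product :: "'a :: comm_semiring_1 poly \<Rightarrow> 'a poly poly" where
  "at_product p = (\<Sum>k\<le>degree p. monom (monom (coeff p k) k) k)"

lemma coeff_at_product: "coeff (at_product p) k = monom (coeff p k) k"
  by (auto simp: at_product_def coeff_sum coeff_eq_0 if_distrib cong: if_cong)

lemma degree_at_product: "degree (at_product p) = degree p"
proof (cases "p = 0")
  case True
  then show ?thesis by (simp add: at_product_def)
next
  case False
  then show ?thesis
    by (intro antisym degree_le le_degree) (simp_all add: coeff_at_product coeff_eq_0)
qed

text \<open>
  Setting \<open>\<xi> = 1\<close> turns a factorisation of \<open>p (\<xi> z)\<close> into one of \<open>p\<close>, so one factor becomes a
  constant. Its leading coefficient in \<open>z\<close> divides a monomial in \<open>\<xi>\<close> and hence does not vanish at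
  \<open>\<xi> = 1\<close>, so this factor was free of \<open>z\<close> from the beginning; it then divides every coefficient,
  in particular the nonzero constant \<open>p 0\<close>.
\<close>
lemma irreducible_at_product:
  fixes p :: "'a :: field poly"
  assumes irr: "irreducible p" and p0: "coeff p 0 \<noteq> 0"
  shows "irreducible (at_product p)"
proof (rule irreducibleI)
  define ev where "ev = map_poly (\<lambda>c :: 'a poly. poly c 1)"
  have ev_mult: "ev (f * g) = ev f * ev g" for f g
    unfolding ev_def by (rule map_poly_mult_hom) auto
  have ev_p: "ev (at_product p) = p"
    by (intro poly_eqI) (simp add: ev_def coeff_map_poly coeff_at_product poly_monom)
  have "p \<noteq> 0" using irr by auto
  then show "at_product p \<noteq> 0" using ev_p by (auto simp: ev_def)
  have unit_ev: "is_unit f" if fg: "at_product p = f * g" and u: "is_unit (ev f)" for f g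
  proof -
    have "monom (lead_coeff p) (degree p) = lead_coeff f * lead_coeff g"
      unfolding lead_coeff_mult[symmetric] fg[symmetric]
      by (simp add: coeff_at_product degree_at_product)
    from arg_cong[OF this, of "\<lambda>q. poly q 1"]
    have "poly (lead_coeff f) 1 * poly (lead_coeff g) 1 = lead_coeff p"
      by (simp add: poly_monom)
    with \<open>p \<noteq> 0\<close> have "poly (lead_coeff f) 1 \<noteq> 0"
      by (metis leading_coeff_0_iff mult_zero_left)
    then have "degree f \<le> degree (ev f)"
      by (intro le_degree) (simp add: ev_def coeff_map_poly)
    also have "degree (ev f) = 0"
      using u by (auto simp: is_unit_poly_iff)
    finally have "degree f = 0" by simp
    then obtain q where q: "f = [:q:]" by (rule degree_eq_zeroE)
    have "[:coeff p 0:] = q * coeff g 0"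
      using arg_cong[OF fg, of "\<lambda>h. coeff h 0"] by (simp add: coeff_at_product q monom_0)
    then have "q dvd [:coeff p 0:]" by simp
    moreover have "is_unit [:coeff p 0:]" using p0 by (simp add: is_unit_const_poly_iff dvd_field_iff)
    ultimately have "is_unit q" by (rule dvd_unit_imp_unit)
    then show ?thesis by (simp add: q is_unit_const_poly_iff)
  qed
  show "\<not> is_unit (at_product p)"
  proof
    assume "is_unit (at_product p)"
    then obtain g where "1 = at_product p * g" by (rule dvdE)
    from arg_cong[OF this, of ev] have "ev 1 = p * ev g" by (simp only: ev_mult ev_p)
    then have "1 = p * ev g" by (simp add: ev_def flip: one_pCons)
    then have "is_unit p" by (rule dvdI)
    then show False using irr by (simp add: irreducible_not_unit)
  qed
  fix f g assume fg: "at_product p = f * g"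
  then have gf: "at_product p = g * f" by (simp only: mult.commute)
  from arg_cong[OF fg, of ev] have "p = ev f * ev g" by (simp only: ev_mult ev_p)
  then have "is_unit (ev f) \<or> is_unit (ev g)" using irr irreducibleD by blast
  then show "is_unit f \<or> is_unit g"
    using unit_ev[OF fg] unit_ev[OF gf] by blast
qed

section \<open>The star product of powers\<close>

lemma of_rat_poly2_at_product: "of_rat_poly2 (at_product p) = at_product (map_poly of_rat p)"
  by (intro poly_eqI) (simp add: of_rat_poly2_def coeff_map_poly coeff_at_product)

lemma map_poly_laguerre_of_rat:
  "map_poly of_rat (laguerre m) = (laguerre m :: complex poly)"
proof -
  have "of_rat (fact n) = (fact n :: complex)" for n
    using of_rat_of_nat_eq[of "fact n"] by (simp only: of_nat_fact)
  then show ?thesis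
    by (intro poly_eqI) (simp add: coeff_map_poly coeff_laguerre of_rat_mult of_rat_power of_rat_minus)
qed

lemma Omega_tensor: "Omega (tensor f g) = tensor (dz f) (dxi g) + tensor (dxi f) (dz g)"
  unfolding Omega_def right_dxi_tensor right_dz_tensor
  by (simp add: left_op_tensor dz_smult dxi_smult)

lemma scale_tensor_tensor: "scale_tensor c (tensor f g) = tensor (smult [:c:] f) g"
  by (intro poly_eqI) (simp add: scale_tensor_def coeff_tensor mult_ac)

lemma xi_power: "xi ^ n = [:monom 1 n:]"
  by (induction n) (simp_all add: xi_def monom_Suc monom_0 pCons_one mult.commute)

lemma zz_power: "zz ^ n = monom 1 n"
  by (induction n) (simp_all add: zz_def monom_Suc)

lemma tensor_0: "tensor 0 g = 0" "tensor f 0 = 0"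
  by (intro poly_eqI; simp add: coeff_tensor)+

lemma dz_xi_power: "dz (smult d (xi ^ n)) = 0"
  by (simp add: dz_def xi_power pderiv_pCons)

lemma dxi_zz_power: "dxi (zz ^ n) = 0"
  by (simp add: dxi_def zz_power map_poly_monom)

lemma dxi_xi_power: "dxi (smult [:c:] (xi ^ n)) = smult [:c * of_nat n:] (xi ^ (n - 1))"
  by (intro poly_eqI)
    (simp add: dxi_def xi_power map_poly_pCons pderiv_smult pderiv_monom smult_monom mult.commute)

lemma dz_zz_power: "dz (zz ^ n) = smult [:of_nat n:] (zz ^ (n - 1))"
  by (simp add: dz_def zz_power pderiv_monom smult_monom of_nat_poly)

lemma tensor_smult_right: "tensor f (smult [:c:] g) = tensor (smult [:c:] f) g"
  by (intro poly_eqI) (simp add: coeff_tensor mult_ac)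

text \<open>Only \<open>\<delta> \<otimes> \<partial>\<close> survives, since \<open>\<partial>\<close> kills powers of \<open>\<xi>\<close> and \<open>\<delta>\<close> kills powers of \<open>z\<close>.
  For \<open>n = 0\<close> both sides vanish.\<close>
lemma Omega_xi_zz_power:
  "Omega (tensor (smult [:c:] (xi ^ n)) (zz ^ n)) =
     tensor (smult [:c * of_nat n ^ 2:] (xi ^ (n - 1))) (zz ^ (n - 1))"
  unfolding Omega_tensor dz_xi_power dxi_zz_power dxi_xi_power dz_zz_power tensor_smult_right
  by (simp add: tensor_0 power2_eq_square mult_ac)

text \<open>The scalar is the square of the falling factorial \<open>m (m - 1) \<dots> (m - k + 1)\<close>; in this form
  it vanishes for \<open>k > m\<close>, where the exponent \<open>m - k\<close> is truncated to \<open>0\<close>.\<close>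
lemma Omega_power_xi_zz_power:
  "(Omega ^^ k) (tensor (xi ^ m) (zz ^ m)) =
     tensor (smult [:(of_nat (fact k * (m choose k))) ^ 2:] (xi ^ (m - k))) (zz ^ (m - k))"
proof (induction k)
  case (Suc k)
  have "fact (Suc k) * (m choose Suc k) = fact k * (Suc k * (m choose Suc k))"
    by (simp only: fact_Suc of_nat_id mult_ac)
  also have "Suc k * (m choose Suc k) = (m choose k) * (m - k)"
    using binomial_absorb_comp[of m k] binomial_absorption[of k m] by (simp only: mult.commute)
  finally have step: "fact (Suc k) * (m choose Suc k) = fact k * (m choose k) * (m - k)"
    by (simp only: mult.assoc)
  have "m - k - 1 = m - Suc k" by simp
  then show ?case
    unfolding funpow.simps comp_apply Suc.IH Omega_xi_zz_power step of_nat_mult power_mult_distrib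
    by (simp only:)
qed (simp flip: one_pCons)

lemma mu_add: "mu (s + t) = mu s + mu t"
proof -
  have "map_poly (\<lambda>p. poly p xi) (s + t) = map_poly (\<lambda>p. poly p xi) s + map_poly (\<lambda>p. poly p xi) t"
    by (intro poly_eqI) (simp add: coeff_map_poly)
  then show ?thesis by (simp add: mu_def)
qed

lemma mu_sum: "mu (\<Sum>i\<in>I. t i) = (\<Sum>i\<in>I. mu (t i))"
  by (induction I rule: infinite_finite_induct) (simp_all add: mu_add, simp_all add: mu_def)

lemma L_eq_laguerre: "L m = at_product (laguerre m)"
proof -
  let ?t = "tensor (xi ^ m) (zz ^ m)"
  have "L m = mu (\<Sum>k\<le>m. scale_tensor ((- 1) ^ k / fact k) ((Omega ^^ k) ?t))"
    unfolding L_def star_def exp_neg_Omega_def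
  proof (intro arg_cong[of _ _ mu] sum.mono_neutral_left ballI)
    show "{k. (Omega ^^ k) ?t \<noteq> 0} \<subseteq> {..m}"
    proof safe
      fix k assume "(Omega ^^ k) ?t \<noteq> 0"
      then show "k \<le> m"
        unfolding Omega_power_xi_zz_power by (cases "k \<le> m") (simp_all add: tensor_0 not_le binomial_eq_0)
    qed
  qed (auto simp: scale_tensor_def)
  also have "\<dots> = (\<Sum>k\<le>m. smult [:(- 1) ^ k / fact k * of_nat (fact k * (m choose k)) ^ 2:]
      (xi ^ (m - k) * zz ^ (m - k)))"
    unfolding mu_sum Omega_power_xi_zz_power scale_tensor_tensor mu_tensor
    by (intro sum.cong refl) (simp add: mult_ac)
  also have "\<dots> = (\<Sum>k\<le>m. monom (monom ((- 1) ^ k * fact k * of_nat (m choose k) ^ 2) (m - k)) (m - k))"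
    by (intro sum.cong refl)
      (simp add: xi_power zz_power smult_monom power_mult_distrib power2_eq_square mult_ac)
  also have "\<dots> = (\<Sum>k\<le>m. monom (monom (coeff (laguerre m) k) k) k)"
    by (rule sum.reindex_bij_witness[of _ "\<lambda>k. m - k" "\<lambda>k. m - k"])
      (auto simp: coeff_laguerre binomial_symmetric[symmetric])
  also have "\<dots> = at_product (laguerre m)"
    by (simp add: at_product_def degree_laguerre)
  finally show ?thesis .
qed

theorem theorem5p9:
  fixes m :: nat
  assumes "m \<ge> 2"
  shows "\<exists>P :: rat poly poly. of_rat_poly2 P = L m \<and> irreducible P"
proof (intro exI conjI)
  show "of_rat_poly2 (at_product (laguerre m)) = L m"
    by (simp add: of_rat_poly2_at_product map_poly_laguerre_of_rat L_eq_laguerre)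
  show "irreducible (at_product (laguerre m :: rat poly))"
    using assms by (intro irreducible_at_product irreducible_laguerre) (auto simp: coeff_laguerre)
qed

end
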